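(* Let $K$ be a convex symmetric set in $\mathbb{R}^n$. Assume there is an orthogonal projection $P$ in $\mathbb{R}^n$ with $\operatorname{rank} P = k$ such that $PK \supseteq PD$. Then for all $0 < \varepsilon < 1$, $$\sigma_{n-1}(K + \varepsilon D) \ \ge\ \sigma^{\mathrm{Lip}}_{n-1,k-1}(\sin^{-1}\varepsilon).$$
   Context: $D$ is the unit Euclidean ball in $\mathbb{R}^n$; $A + B = \{a+b : a \in A, b \in B\}$ is the Minkowski sum; a set $K$ is symmetric if $K=-K$. $\sigma_{m}$ is the normalized (total mass one) Lebesgue measure on the unit Euclidean sphere $S^m\subset\mathbb{R}^{m+1}$; for a set $A \subset \mathbb{R}^n$ one writes $\sigma_{n-1}(A)$ for $\sigma_{n-1}(A \cap S^{n-1})$, if measurable. For $A \subset S^m$ and $\theta>0$, $A_\theta = \{y \in S^m : d(x,y) \le \theta \text{ for some } x \in A\}$, where $d$ is the geodesic distance on $S^m$. For integers $0 \le j \le m$ and $0<\theta<\pi/2$, $$\sigma^{\mathrm{Lip}}_{m,j}(\theta) = \inf_f \sigma_m\big((f(S^j))_\theta\big),$$ where the infimum is over all continuous odd maps $f : S^j \to S^m$ (odd: $f(-x) = -f(x)$ for all $x$). *)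

theory Defs
  imports "HOL-Analysis.Analysis"
begin

text \<open>
  The normalized Lebesgue measure on the unit sphere of a Euclidean space \<open>'a\<close>, that is, on
  \<open>S\<^sup>m\<close> with \<open>m = DIM('a) - 1\<close>, given by polar coordinates: the measure of a Borel set
  \<open>B\<close> of the sphere is the proportion of the unit ball occupied by the cone
  \<open>{t *\<^sub>R x |t x. 0 < t \<and> t \<le> 1 \<and> x \<in> B}\<close>. The centre, where \<open>sgn 0 = 0\<close> is off the sphere, is
  a null set. For \<open>DIM('a) = 1\<close> both points of \<open>S\<^sup>0\<close> get mass \<open>1/2\<close>.
\<close>

definition sphere_measure :: "'a::euclidean_space measure"
  where "sphere_measure =
    completion (restrict_space (distr (uniform_measure lborel (cball 0 1)) borel sgn) (sphere 0 1))"

lemma space_sphere_measure: "space (sphere_measure :: 'a::euclidean_space measure) = sphere 0 1"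
  by (simp add: sphere_measure_def space_restrict_space)

lemma sgn_borel_measurable_euclidean:
  "(sgn :: 'a::euclidean_space \<Rightarrow> 'a) \<in> borel_measurable borel"
  unfolding sgn_div_norm by measurable

lemma sets_sphere_measure_borel:
  fixes B :: "'a::euclidean_space set"
  assumes "B \<in> sets borel" "B \<subseteq> sphere 0 1"
  shows "B \<in> sets sphere_measure"
  unfolding sphere_measure_def
  by (rule sets_completionI_sets) (use assms in \<open>auto simp: sets_restrict_space_iff\<close>)

lemma emeasure_sphere_measure_borel:
  fixes B :: "'a::euclidean_space set"
  assumes "B \<in> sets borel" "B \<subseteq> sphere 0 1"
  shows "emeasure sphere_measure B =
    emeasure lborel (cball 0 1 \<inter> sgn -` B) / emeasure lborel (cball (0::'a) 1)"
proof -
  let ?D = "distr (uniform_measure lborel (cball (0::'a) 1)) borel sgn"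
  have m: "(sgn :: 'a \<Rightarrow> 'a) \<in> measurable (uniform_measure lborel (cball 0 1)) borel"
    using sgn_borel_measurable_euclidean by (simp add: measurable_def)
  have s: "sgn -` B \<in> sets (borel :: 'a measure)"
    using measurable_sets[OF sgn_borel_measurable_euclidean assms(1)] by simp
  have "emeasure sphere_measure B = emeasure (restrict_space ?D (sphere 0 1)) B"
  proof -
    have "B \<in> sets (restrict_space ?D (sphere 0 1))"
      using assms by (subst sets_restrict_space_iff) auto
    then show ?thesis by (simp add: sphere_measure_def)
  qed
  also have "\<dots> = emeasure ?D B"
    by (rule emeasure_restrict_space) (use assms in auto)
  also have "\<dots> = emeasure (uniform_measure lborel (cball (0::'a) 1)) (sgn -` B)"
    using m assms by (simp add: emeasure_distr)
  also have "\<dots> = emeasure lborel (cball 0 1 \<inter> sgn -` B) / emeasure lborel (cball (0::'a) 1)"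
    using s by simp
  finally show ?thesis .
qed

lemma emeasure_sphere_measure_space:
  "emeasure sphere_measure (sphere (0::'a::euclidean_space) 1) = 1"
proof -
  have eq: "cball 0 1 \<inter> sgn -` sphere 0 1 = cball (0::'a) 1 - {0}"
    by (auto simp: norm_sgn)
  have "emeasure lborel (cball (0::'a) 1 - {0}) = emeasure lborel (cball (0::'a) 1)"
    by (rule emeasure_Diff_null_set) auto
  moreover have "emeasure lborel (cball (0::'a) 1) \<noteq> 0"
  proof
    assume "emeasure lborel (cball (0::'a) 1) = 0"
    moreover have "emeasure lborel (ball (0::'a) 1) \<le> emeasure lborel (cball (0::'a) 1)"
      by (rule emeasure_mono) auto
    ultimately have "ball (0::'a) 1 \<in> null_sets lborel"
      by (simp add: null_sets_def)
    then show False
      using open_not_negligible[of "ball (0::'a) 1"]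
      by (auto simp: negligible_iff_null_sets null_sets_completionI)
  qed
  moreover have "emeasure lborel (cball (0::'a) 1) \<noteq> top"
    using emeasure_lborel_cball_finite[of "0::'a" 1] by simp
  ultimately show ?thesis
    by (subst emeasure_sphere_measure_borel) (auto simp: eq ennreal_divide_self less_top)
qed

definition geodesic_dist :: "'a::euclidean_space \<Rightarrow> 'a \<Rightarrow> real"
  where "geodesic_dist x y = arccos (x \<bullet> y)"

definition sphere_nbhd :: "'a::euclidean_space set \<Rightarrow> real \<Rightarrow> 'a set"
  where "sphere_nbhd A \<theta> = {y \<in> sphere 0 1. \<exists>x\<in>A. geodesic_dist x y \<le> \<theta>}"

text \<open>
  \<open>sigma_Lip TYPE('a) j \<theta>\<close> is \<open>\<sigma>\<^sup>L\<^sup>i\<^sup>p\<close> with indices \<open>m = DIM('a) - 1\<close> and \<open>j\<close>. The domain \<open>S\<^sup>j\<close>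
  is \<^const>\<open>nsphere\<close>, whose points are functions \<open>nat \<Rightarrow> real\<close> vanishing beyond \<open>j\<close>. For \<open>j > m\<close>
  there are no continuous odd maps and the value is unspecified.
\<close>

definition odd_sphere_map :: "nat \<Rightarrow> ((nat \<Rightarrow> real) \<Rightarrow> 'a::euclidean_space) \<Rightarrow> bool"
  where "odd_sphere_map j f \<longleftrightarrow>
    continuous_map (nsphere j) (top_of_set (sphere 0 1)) f \<and>
    (\<forall>x\<in>topspace (nsphere j). f (\<lambda>i. - x i) = - f x)"

definition sigma_Lip :: "'a::euclidean_space itself \<Rightarrow> nat \<Rightarrow> real \<Rightarrow> real"
  where "sigma_Lip _ j \<theta> =
    (INF f \<in> {f :: (nat \<Rightarrow> real) \<Rightarrow> 'a. odd_sphere_map j f}.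
      measure sphere_measure (sphere_nbhd (f ` topspace (nsphere j)) \<theta>))"

definition orthogonal_projection :: "('a::euclidean_space \<Rightarrow> 'a) \<Rightarrow> bool"
  where "orthogonal_projection P \<longleftrightarrow>
    linear P \<and> P \<circ> P = P \<and> (\<forall>x y. P x \<bullet> y = x \<bullet> P y)"

end

theory Submission
  imports Defs
begin

text \<open>
  It suffices to find one odd continuous map \<open>f\<close> from the sphere of dimension \<open>k - 1\<close> to the unit
  sphere, all of whose points have their cap of angular radius \<open>arcsin \<epsilon>\<close> inside \<open>K + \<epsilon>D\<close>. If \<open>p\<close> is
  a point of \<open>K\<close> with \<open>norm p \<ge> 1\<close>, the direction of \<open>p\<close> has this property: a unit vector \<open>y\<close> in
  the cap projects orthogonally onto the line through \<open>p\<close> at a point of the segment from \<open>0\<close> to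
  \<open>p\<close>, and its distance to that point is the sine of its angle to \<open>p\<close>. So a continuous odd
  selection of preimages in \<open>K\<close> of the unit vectors in the range of \<open>P\<close> would give \<open>f\<close>, because
  preimages have norm at least \<open>1\<close>.

  An exact continuous selection need not exist: when the unit circle is the boundary of \<open>P K\<close>, each
  of its points is extreme in \<open>P K\<close> and may have a single preimage, which may jump as the point
  moves. However, the cap property survives when \<open>norm p\<close> is only at least
  \<open>sqrt (1 - \<epsilon>\<^sup>2) = cos (arcsin \<epsilon>)\<close>, which is less than \<open>1\<close> (\<open>cap_subset_segment_plus_ball\<close>).
  This leaves room for an approximate selection, and one can be written down: lift a finite net of
  the sphere arbitrarily, interpolate with a partition of unity, and take the odd part
  (\<open>approximate_odd_lift\<close>). Convexity and symmetry of \<open>K\<close> keep the result in \<open>K\<close>.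
\<close>

section \<open>Approximate odd lifts into convex symmetric sets\<close>

text \<open>
  Averaging arbitrary lifts of net points near \<open>x\<close> gives a point of \<open>K\<close> whose image under \<open>P\<close> is an
  average of points near \<open>x\<close>. The lifts themselves can be chosen without any regularity, since
  only the weights depend on \<open>x\<close>.
\<close>

lemma approximate_odd_lift:
  fixes P :: "'a::real_normed_vector \<Rightarrow> 'b::real_normed_vector"
  assumes P: "linear P" and K: "convex K" "K = uminus ` K"
    and S: "compact S" "S = uminus ` S" "S \<subseteq> P ` K" and "0 < \<delta>"
  obtains s where "continuous_on S s"
    "\<And>x. x \<in> S \<Longrightarrow> s x \<in> K" "\<And>x. x \<in> S \<Longrightarrow> s (- x) = - s x"
    "\<And>x. x \<in> S \<Longrightarrow> dist (P (s x)) x \<le> \<delta>"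
proof -
  have negS: "- x \<in> S" if "x \<in> S" for x using that S(2) by blast
  have negK: "- x \<in> K" if "x \<in> K" for x using that K(2) by blast
  have "\<forall>v\<in>S. \<exists>w. w \<in> K \<and> P w = v" using S(3) by blast
  from bchoice[OF this] obtain l where l: "\<And>v. v \<in> S \<Longrightarrow> l v \<in> K \<and> P (l v) = v"
    by blast
  obtain N where N: "finite N" "N \<subseteq> S" "S \<subseteq> (\<Union>v\<in>N. ball v \<delta>)"
  proof (rule compactE_image[OF S(1)])
    show "open (ball v \<delta>)" for v :: 'b by simp
    show "S \<subseteq> (\<Union>v\<in>S. ball v \<delta>)" using \<open>0 < \<delta>\<close> by force
  qed
  \<comment> \<open>Tent functions; normalised by \<open>W\<close> they form a partition of unity on \<open>S\<close>.\<close>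
  define \<phi> where "\<phi> v x = max 0 (\<delta> - dist v x)" for v x :: 'b
  define W where "W x = (\<Sum>v\<in>N. \<phi> v x)" for x
  define a where "a x = (\<Sum>v\<in>N. (\<phi> v x / W x) *\<^sub>R l v)" for x
  have W_pos: "0 < W x" if "x \<in> S" for x
  proof -
    obtain v where "v \<in> N" "dist v x < \<delta>" using N(3) \<open>x \<in> S\<close> by auto
    then show ?thesis
      unfolding W_def by (intro sum_pos2[of N v]) (auto simp: N(1) \<phi>_def)
  qed
  have wt_nonneg: "0 \<le> \<phi> v x / W x" if "x \<in> S" for v x
    using W_pos[OF that] by (simp add: \<phi>_def)
  have wt_sum: "(\<Sum>v\<in>N. \<phi> v x / W x) = 1" if "x \<in> S" for x
    using W_pos[OF that] by (simp add: W_def flip: sum_divide_distrib)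
  have \<phi>_cont: "continuous_on S (\<phi> v)" for v
    unfolding \<phi>_def by (intro continuous_intros)
  then have "continuous_on S W"
    unfolding W_def by (intro continuous_intros)
  then have a_cont: "continuous_on S a"
    unfolding a_def using W_pos
    by (intro continuous_on_sum continuous_on_scaleR continuous_on_divide \<phi>_cont continuous_on_const)
       (simp_all add: less_imp_neq[symmetric])
  have a_K: "a x \<in> K" if "x \<in> S" for x
    unfolding a_def using l N(2) wt_nonneg[OF that] wt_sum[OF that]
    by (intro convex_sum[OF N(1) K(1)]) auto
  have a_dist: "norm (P (a x) - x) \<le> \<delta>" if "x \<in> S" for x
  proof -
    have "P (a x) - x = (\<Sum>v\<in>N. (\<phi> v x / W x) *\<^sub>R v) - (\<Sum>v\<in>N. \<phi> v x / W x) *\<^sub>R x"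
      using l N(2) wt_sum[OF that]
      by (simp add: a_def linear_sum[OF P] linear_scale[OF P] subset_iff)
    also have "\<dots> = (\<Sum>v\<in>N. (\<phi> v x / W x) *\<^sub>R (v - x))"
      by (simp add: scaleR_sum_left sum_subtractf scaleR_diff_right)
    also have "norm \<dots> \<le> (\<Sum>v\<in>N. (\<phi> v x / W x) * \<delta>)"
    proof (rule sum_norm_le)
      fix v
      have "\<phi> v x * norm (v - x) \<le> \<phi> v x * \<delta>"
        by (cases "dist v x \<le> \<delta>") (auto simp: \<phi>_def dist_norm intro: mult_left_mono)
      then show "norm ((\<phi> v x / W x) *\<^sub>R (v - x)) \<le> \<phi> v x / W x * \<delta>"
        using W_pos[OF that] wt_nonneg[OF that, of v]
        by (simp add: divide_right_mono \<phi>_def)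
    qed
    also have "\<dots> = \<delta>" by (simp only: wt_sum[OF that] mult_1_left flip: sum_distrib_right)
    finally show ?thesis .
  qed
  \<comment> \<open>The odd part of \<open>a\<close>: it is a midpoint of two points of \<open>K\<close>, and the error bound is kept
      because the identity map is odd.\<close>
  define s where "s x = (1/2) *\<^sub>R a x + (1/2) *\<^sub>R (- a (- x))" for x
  show ?thesis
  proof (rule that[of s])
    have "continuous_on S (\<lambda>x. a (- x))"
      by (rule continuous_on_compose2[OF a_cont]) (auto intro: continuous_intros negS)
    then show "continuous_on S s"
      unfolding s_def by (intro continuous_intros a_cont)
  next
    fix x assume x: "x \<in> S"
    show "s x \<in> K"
      unfolding s_def by (rule convexD[OF K(1)]) (use x in \<open>auto intro: a_K negK negS\<close>)
    show "s (- x) = - s x"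
      by (simp add: s_def algebra_simps)
    have "P (s x) - x = (1/2) *\<^sub>R (P (a x) - x) - (1/2) *\<^sub>R (P (a (- x)) - (- x))"
      by (simp add: s_def linear_add[OF P] linear_diff[OF P] linear_neg[OF P] linear_scale[OF P]
          algebra_simps flip: scaleR_add_left)
    also have "norm \<dots> \<le> (1/2) * norm (P (a x) - x) + (1/2) * norm (P (a (- x)) - (- x))"
      by (rule order_trans[OF norm_triangle_ineq4]) simp
    also have "\<dots> \<le> \<delta>"
      using a_dist[OF x] a_dist[OF negS[OF x]] by simp
    finally show "dist (P (s x)) x \<le> \<delta>" by (simp add: dist_norm)
  qed
qed

section \<open>Spherical caps in enlargements of convex sets\<close>

text \<open>
  Approximate \<open>y\<close> by its orthogonal projection onto the line through \<open>p\<close> if that lies on the segment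
  from \<open>0\<close> to \<open>p\<close>, and by \<open>p\<close> itself if it lies beyond. In the second case
  \<open>y \<bullet> p \<ge> (norm p)\<^sup>2\<close>, so the squared distance is at most \<open>1 - (norm p)\<^sup>2 \<le> \<epsilon>\<^sup>2\<close>.
\<close>

lemma cap_subset_segment_plus_ball:
  fixes K :: "'a::euclidean_space set"
  assumes K: "convex K" "0 \<in> K" "p \<in> K"
    and \<epsilon>: "0 < \<epsilon>" "\<epsilon> < 1" and p: "sqrt (1 - \<epsilon>\<^sup>2) \<le> norm p"
    and y: "norm y = 1" "geodesic_dist (sgn p) y \<le> arcsin \<epsilon>"
  shows "y \<in> K + (*\<^sub>R) \<epsilon> ` cball 0 1"
proof -
  define u where "u = sgn p"
  define c where "c = u \<bullet> y"
  have eps2: "\<epsilon>\<^sup>2 < 1" using \<epsilon> by (simp add: power_less_one_iff abs_square_less_1)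
  then have r0: "0 < sqrt (1 - \<epsilon>\<^sup>2)" by simp
  with p have p0: "p \<noteq> 0" by auto
  then have u: "norm u = 1" by (simp add: u_def norm_sgn)
  have c_bound: "\<bar>c\<bar> \<le> 1" using Cauchy_Schwarz_ineq2[of u y] u y by (simp add: c_def)
  have "sqrt (1 - \<epsilon>\<^sup>2) = cos (arcsin \<epsilon>)" using \<epsilon> by (simp add: cos_arcsin)
  also have "\<dots> \<le> cos (arccos c)"
  proof (rule cos_monotone_0_pi_le)
    show "0 \<le> arccos c" using c_bound by (intro arccos_lbound) auto
    show "arccos c \<le> arcsin \<epsilon>" using y(2) by (simp add: geodesic_dist_def c_def u_def)
    show "arcsin \<epsilon> \<le> pi" using arcsin_ubound[of \<epsilon>] \<epsilon> pi_gt_zero by linarith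
  qed
  also have "\<dots> = c" using c_bound by (simp add: cos_arccos_abs)
  finally have cr: "sqrt (1 - \<epsilon>\<^sup>2) \<le> c" .
  \<comment> \<open>Both cases at once: the approximating point is \<open>t *\<^sub>R u\<close>, and all that the distance estimate
      uses of \<open>t\<close> is that it lies between \<open>sqrt (1 - \<epsilon>\<^sup>2)\<close> and \<open>c\<close>.\<close>
  define t where "t = min c (norm p)"
  have t0: "0 \<le> t" and tr: "sqrt (1 - \<epsilon>\<^sup>2) \<le> t" using cr p r0 unfolding t_def by linarith+
  have tK: "t *\<^sub>R u \<in> K"
  proof -
    have "(t / norm p) *\<^sub>R p + (1 - t / norm p) *\<^sub>R 0 \<in> K"
      using t0 p0 by (intro convexD[OF K(1) K(3) K(2)]) (auto simp: t_def)
    also have "(t / norm p) *\<^sub>R p + (1 - t / norm p) *\<^sub>R 0 = t *\<^sub>R u"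
      by (simp add: u_def sgn_div_norm divide_inverse)
    finally show ?thesis .
  qed
  have "(norm (y - t *\<^sub>R u))\<^sup>2 = 1 - 2 * t * c + t\<^sup>2"
    using u y(1) unfolding power2_norm_eq_inner norm_eq_1 c_def
    by (simp add: inner_diff_left inner_diff_right inner_commute algebra_simps power2_eq_square)
  also have "\<dots> \<le> 1 - t\<^sup>2"
    using mult_left_mono[of t c t] t0 by (simp add: t_def power2_eq_square)
  also have "\<dots> \<le> \<epsilon>\<^sup>2"
    using power_mono[OF tr, of 2] r0 eps2 by simp
  finally have le: "norm (y - t *\<^sub>R u) \<le> \<epsilon>"
    using \<epsilon> by (simp add: power2_le_iff_abs_le)
  have "y = t *\<^sub>R u + \<epsilon> *\<^sub>R ((1 / \<epsilon>) *\<^sub>R (y - t *\<^sub>R u))"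
    using \<epsilon> by simp
  moreover have "(1 / \<epsilon>) *\<^sub>R (y - t *\<^sub>R u) \<in> cball 0 1"
    using le \<epsilon> by simp
  ultimately show ?thesis using tK by (metis imageI set_plus_intro)
qed

section \<open>The unit sphere of a subspace\<close>

text \<open>
  The coordinate map of an orthonormal basis; it translates between the sphere of coordinate
  sequences and the unit sphere of a subspace.
\<close>

lemma odd_map_nsphere_to_subspace:
  fixes V :: "'a::euclidean_space set"
  assumes V: "subspace V" "dim V = Suc j"
  obtains e where "continuous_map (nsphere j) (top_of_set (V \<inter> sphere 0 1)) e"
    "\<And>x. e (\<lambda>i. - x i) = - e x"
proof -
  obtain B where B: "B \<subseteq> V" "pairwise orthogonal B" "\<And>x. x \<in> B \<Longrightarrow> norm x = 1" "card B = dim V"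
    using orthonormal_basis_subspace[OF V(1)] by metis
  have "finite B" using B(4) V(2) by (simp add: card_ge_0_finite)
  then obtain b where b: "bij_betw b {..j} B"
    using B(4) V(2) by (metis card_atMost finite_atMost finite_same_card_bij)
  define e where "e x = (\<Sum>i\<le>j. x i *\<^sub>R b i)" for x
  have bV: "b i \<in> B" if "i \<le> j" for i using b that by (auto simp: bij_betw_def)
  have orth: "b i \<bullet> b i' = (if i = i' then 1 else 0)" if "i \<le> j" "i' \<le> j" for i i'
  proof (cases "i = i'")
    case True then show ?thesis using B(3)[OF bV[OF that(1)]] by (simp add: norm_eq_1)
  next
    case False
    then have "b i \<noteq> b i'" using b that by (auto simp: bij_betw_def inj_on_def)
    then show ?thesis using B(2) bV that False by (auto simp: pairwise_def orthogonal_def)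
  qed
  have norm_e: "e x \<bullet> e x = (\<Sum>i\<le>j. (x i)\<^sup>2)" for x
  proof -
    have "e x \<bullet> e x = (\<Sum>i\<le>j. \<Sum>i'\<le>j. x i * (x i' * (b i' \<bullet> b i)))"
      by (simp add: e_def inner_sum_left inner_sum_right sum_distrib_left mult_ac)
    also have "\<dots> = (\<Sum>i\<le>j. \<Sum>i'\<le>j. if i = i' then x i * x i' else 0)"
      by (intro sum.cong refl) (auto simp: orth)
    also have "\<dots> = (\<Sum>i\<le>j. (x i)\<^sup>2)"
      by (intro sum.cong refl) (simp add: power2_eq_square)
    finally show ?thesis .
  qed
  show ?thesis
  proof (rule that[of e])
    have "continuous_map (nsphere j) euclidean e"
      unfolding e_def
    proof (rule continuous_map_sum)
      fix i
      have "continuous_map euclidean euclidean (\<lambda>c::real. c *\<^sub>R b i)"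
        by (simp add: continuous_on_scaleR)
      from continuous_map_compose[OF continuous_map_nsphere_projection this]
      show "continuous_map (nsphere j) euclidean (\<lambda>x. x i *\<^sub>R b i)"
        by (simp add: o_def)
    qed simp
    moreover have "e x \<in> V" for x
      unfolding e_def using bV B(1)
      by (intro subspace_sum[OF V(1)] subspace_scale[OF V(1)]) auto
    moreover have "norm (e x) = 1" if "x \<in> topspace (nsphere j)" for x
      using that norm_e[of x] by (simp add: nsphere norm_eq_1)
    ultimately show "continuous_map (nsphere j) (top_of_set (V \<inter> sphere 0 1)) e"
      by (auto simp: continuous_map_in_subtopology)
    show "e (\<lambda>i. - x i) = - e x" for x
      by (simp add: e_def sum_negf)
  qed
qed

section \<open>Comparison of measures on the sphere\<close>

lemma norm_orthogonal_projection_le: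
  assumes "orthogonal_projection P"
  shows "norm (P x) \<le> norm x"
proof -
  have "norm (P x) * norm (P x) = P x \<bullet> P x"
    by (simp add: power2_norm_eq_inner flip: power2_eq_square)
  also have "\<dots> = x \<bullet> P x"
    using assms unfolding orthogonal_projection_def by (metis comp_apply)
  also have "\<dots> \<le> norm x * norm (P x)" by (rule norm_cauchy_schwarz)
  finally show ?thesis by (cases "P x = 0") auto
qed

lemma finite_measure_sphere_measure:
  "finite_measure (sphere_measure :: 'a::euclidean_space measure)"
  by (rule finite_measureI) (simp add: space_sphere_measure emeasure_sphere_measure_space)

theorem proposition3p1:
  fixes K :: "(real ^ 'n) set" and P :: "real ^ 'n \<Rightarrow> real ^ 'n" and k :: nat and \<epsilon> :: real
  assumes "convex K" and "K = uminus ` K"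
    and "orthogonal_projection P" and "dim (range P) = k" and "k \<ge> 1"
    and "P ` cball 0 1 \<subseteq> P ` K"
    and "0 < \<epsilon>" and "\<epsilon> < 1"
    and "(K + (*\<^sub>R) \<epsilon> ` cball 0 1) \<inter> sphere 0 1 \<in> sets sphere_measure"
  shows "measure sphere_measure ((K + (*\<^sub>R) \<epsilon> ` cball 0 1) \<inter> sphere 0 1)
    \<ge> sigma_Lip TYPE(real ^ 'n) (k - 1) (arcsin \<epsilon>)"
proof -
  let ?S = "range P \<inter> sphere 0 1" and ?r = "sqrt (1 - \<epsilon>\<^sup>2)"
  have P: "linear P" and PP: "\<And>x. P (P x) = P x"
    using assms(3) unfolding orthogonal_projection_def by (auto simp: fun_eq_iff)
  have V: "subspace (range P)" using P by (simp add: linear_subspace_image)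
  have r: "0 < ?r" "?r < 1" using assms(7,8) by (auto simp: abs_square_less_1)
  obtain e where e: "continuous_map (nsphere (k - 1)) (top_of_set ?S) e"
      "\<And>x. e (\<lambda>i. - x i) = - e x"
    using odd_map_nsphere_to_subspace[OF V, of "k - 1"] assms(4,5) by auto
  have "compact ?S" by (simp add: V closed_subspace closed_Int_compact)
  moreover have "?S = uminus ` ?S"
  proof -
    have neg: "- x \<in> ?S" if "x \<in> ?S" for x using that subspace_neg[OF V] by simp
    show ?thesis
    proof
      show "?S \<subseteq> uminus ` ?S"
      proof
        fix x assume "x \<in> ?S"
        from neg[OF this] show "x \<in> uminus ` ?S" by (metis image_eqI minus_minus)
      qed
    qed (use neg in blast)
  qed
  moreover have "?S \<subseteq> P ` K"
  proof
    fix x assume x: "x \<in> ?S"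
    then have "x = P x" using PP by auto
    with x have "x \<in> P ` cball 0 1" by (metis IntD2 image_eqI mem_cball_0 mem_sphere_0 order_refl)
    with assms(6) show "x \<in> P ` K" by blast
  qed
  \<comment> \<open>The admissible error \<open>1 - ?r\<close> is what the cap lemma tolerates as a loss of norm.\<close>
  ultimately obtain s where s: "continuous_on ?S s"
    "\<And>x. x \<in> ?S \<Longrightarrow> s x \<in> K" "\<And>x. x \<in> ?S \<Longrightarrow> s (- x) = - s x"
    "\<And>x. x \<in> ?S \<Longrightarrow> dist (P (s x)) x \<le> 1 - ?r"
    using approximate_odd_lift[OF P assms(1,2), of ?S "1 - ?r"] less_diff_eq[of 0 1 ?r] r(2)
    by (metis add_0)
  have s_norm: "?r \<le> norm (s x)" if "x \<in> ?S" for x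
    using s(4)[OF that] norm_triangle_ineq2[of x "P (s x)"] that
      norm_orthogonal_projection_le[OF assms(3), of "s x"]
    by (simp add: dist_norm norm_minus_commute)
  then have s_nz: "s x \<noteq> 0" if "x \<in> ?S" for x using that r(1) by fastforce
  have e_S: "e x \<in> ?S" if "x \<in> topspace (nsphere (k - 1))" for x
    using e(1) that by (auto simp: continuous_map_def)
  define f where "f x = sgn (s (e x))" for x
  have "continuous_on ?S (\<lambda>x. sgn (s x))"
    using s(1) s_nz unfolding sgn_div_norm by (intro continuous_intros) auto
  then have "continuous_map (top_of_set ?S) (top_of_set (sphere 0 1)) (\<lambda>x. sgn (s x))"
    using s_nz by (auto simp: continuous_map_in_subtopology norm_sgn)
  from continuous_map_compose[OF e(1) this]
  have f_cont: "continuous_map (nsphere (k - 1)) (top_of_set (sphere 0 1)) f"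
    by (simp add: f_def[abs_def] o_def)
  have "f (\<lambda>i. - x i) = - f x" if "x \<in> topspace (nsphere (k - 1))" for x
    using s(3)[OF e_S[OF that]] by (simp add: f_def e(2) sgn_minus)
  with f_cont have f: "odd_sphere_map (k - 1) f" by (simp add: odd_sphere_map_def)
  have zero: "0 \<in> K"
  proof -
    obtain z where "z \<in> K" using assms(6) by fastforce
    moreover from this have "- z \<in> K" using assms(2) by blast
    ultimately have "(1/2) *\<^sub>R z + (1/2) *\<^sub>R (- z) \<in> K" by (intro convexD[OF assms(1)]) auto
    then show ?thesis by simp
  qed
  have sub: "sphere_nbhd (f ` topspace (nsphere (k - 1))) (arcsin \<epsilon>)
      \<subseteq> (K + (*\<^sub>R) \<epsilon> ` cball 0 1) \<inter> sphere 0 1"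
  proof
    fix y assume "y \<in> sphere_nbhd (f ` topspace (nsphere (k - 1))) (arcsin \<epsilon>)"
    then obtain x where x: "x \<in> topspace (nsphere (k - 1))" and y: "norm y = 1"
      "geodesic_dist (f x) y \<le> arcsin \<epsilon>"
      by (auto simp: sphere_nbhd_def)
    have "y \<in> K + (*\<^sub>R) \<epsilon> ` cball 0 1"
      using cap_subset_segment_plus_ball[OF assms(1) zero s(2)[OF e_S[OF x]] assms(7,8)
          s_norm[OF e_S[OF x]] y(1)] y(2)
      by (simp add: f_def)
    with y show "y \<in> (K + (*\<^sub>R) \<epsilon> ` cball 0 1) \<inter> sphere 0 1" by simp
  qed
  have "sigma_Lip TYPE(real ^ 'n) (k - 1) (arcsin \<epsilon>)
      \<le> measure sphere_measure (sphere_nbhd (f ` topspace (nsphere (k - 1))) (arcsin \<epsilon>))"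
    unfolding sigma_Lip_def using f by (intro cINF_lower bdd_belowI2[of _ 0]) auto
  also have "\<dots> \<le> measure sphere_measure ((K + (*\<^sub>R) \<epsilon> ` cball 0 1) \<inter> sphere 0 1)"
    by (rule finite_measure.finite_measure_mono[OF finite_measure_sphere_measure sub assms(9)])
  finally show ?thesis .
qed

end
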